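(* Let $\alpha>0$, $\delta\in(0,1)$, $A>1$, let $1\leq k\leq n$ be integers and let $0<x_1\leq\dots\leq x_n$ be real numbers. For each $j\leq n$ set $b_j:=\sum_{i=j}^n 1/x_i$. Let $\xi_1,\dots,\xi_n$ be (possibly dependent) random variables, each satisfying the $\alpha$-condition and the cdf-decay condition with parameters $\delta$ and $A$. Then $$\mathrm{Med}\Big(k\text{-}\min_{1\leq i\leq n}|x_i\xi_i|\Big)\;\geq\;\frac{\delta}{2A\alpha}\,\max_{1\leq j\leq k}\frac{k-j+1}{b_j}.$$
   Context: For a real sequence $a_1,\dots,a_n$ and $1\leq k\leq n$, $k\text{-}\min_{1\leq i\leq n}a_i$ denotes its $k$-th smallest element (counted with multiplicity). $\mathrm{Med}(Z)$ denotes a median of the real random variable $Z$, i.e. a number $M$ with $\mathbb{P}(Z<M)\leq 1/2$ and $\mathbb{P}(Z\leq M)\geq 1/2$ (any choice of median). A random variable $\xi$ satisfies the $\alpha$-condition if $\mathbb{P}(|\xi|\leq t)\leq\alpha t$ for every $t\geq 0$. A random variable $\xi$ satisfies the cdf-decay condition with parameters $\delta\in(0,1)$ and $A>1$ if the cumulative distribution function $F(t)=\mathbb{P}(|\xi|\leq t)$ of $|\xi|$ satisfies $F(t)\geq 2F(t/A)$ whenever $F(t)\leq\delta$. *)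

theory Defs
  imports "HOL-Probability.Probability"
begin

text \<open>The \<open>k\<close>-th smallest element, counted with multiplicity, of the sequence
  \<open>a 1, \<dots>, a n\<close>. It is meaningful for \<open>1 \<le> k \<le> n\<close>; the shift is due to
  the 0-based list indexing.\<close>

definition kmin :: "nat \<Rightarrow> nat \<Rightarrow> (nat \<Rightarrow> real) \<Rightarrow> real" where
  "kmin k n a = sort (map a [1..<Suc n]) ! (k - 1)"

text \<open>Medians need not be unique, so ``a median'' is a predicate on the value \<open>m\<close>.\<close>

definition is_median :: "'a measure \<Rightarrow> ('a \<Rightarrow> real) \<Rightarrow> real \<Rightarrow> bool" where
  "is_median M Z m \<longleftrightarrow>
     \<P>(\<omega> in M. Z \<omega> < m) \<le> 1/2 \<and> \<P>(\<omega> in M. Z \<omega> \<le> m) \<ge> 1/2"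

definition alpha_condition :: "'a measure \<Rightarrow> real \<Rightarrow> ('a \<Rightarrow> real) \<Rightarrow> bool" where
  "alpha_condition M \<alpha> \<xi> \<longleftrightarrow> (\<forall>t\<ge>0. \<P>(\<omega> in M. \<bar>\<xi> \<omega>\<bar> \<le> t) \<le> \<alpha> * t)"

definition cdf_decay :: "'a measure \<Rightarrow> real \<Rightarrow> real \<Rightarrow> ('a \<Rightarrow> real) \<Rightarrow> bool" where
  "cdf_decay M \<delta> A \<xi> \<longleftrightarrow>
     (let F = (\<lambda>t. \<P>(\<omega> in M. \<bar>\<xi> \<omega>\<bar> \<le> t))
      in \<forall>t. F t \<le> \<delta> \<longrightarrow> F t \<ge> 2 * F (t / A))"

end

theory Submission
  imports Defs
begin

text \<open>If the \<open>k\<close>-th smallest of the numbers \<open>\<bar>x\<^sub>i \<xi>\<^sub>i\<bar>\<close> is at most \<open>t\<close>, then at least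
  \<open>k\<close> of them are, and at least \<open>k - j + 1\<close> of these have index \<open>i \<ge> j\<close>. By Markov's
  inequality and the \<open>\<alpha>\<close>-condition this happens with probability at most
  \<open>\<alpha> t b\<^sub>j / (k - j + 1)\<close>. A median \<open>t\<close> makes this at least \<open>1/2\<close>, and \<open>\<delta> / A \<le> 1\<close>.\<close>

text \<open>In the sorted list every entry at a position below \<open>k\<close> is bounded by the
  one at position \<open>k - 1\<close>, so \<open>k\<close> positions carry values at most
  \<open>t\<close>.\<close>

lemma kmin_le_imp_card_ge:
  assumes "1 \<le> k" "k \<le> n" "kmin k n a \<le> t"
  shows "k \<le> card {i \<in> {1..n}. a i \<le> t}"
proof -
  define s where "s = sort (map a [1..<Suc n])"
  have len: "length s = n"
    by (simp add: s_def)
  have "s ! i \<le> t" if "i < k" for i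
  proof -
    have "s ! i \<le> s ! (k - 1)"
      using that assms len by (intro sorted_nth_mono) (auto simp: s_def)
    then show ?thesis
      using assms(3) by (simp add: kmin_def s_def)
  qed
  then have "{..<k} \<subseteq> {i. i < length s \<and> s ! i \<le> t}"
    using assms(2) len by auto
  then have "k \<le> card {i. i < length s \<and> s ! i \<le> t}"
    using card_mono[of "{i. i < length s \<and> s ! i \<le> t}" "{..<k}"] by simp
  \<comment> \<open>Positions in \<open>s\<close> are traded for indices of \<open>a\<close>:
    filtering commutes with sorting, and sorting keeps the length. Counting indices rather than
    values respects multiplicity.\<close>
  also have "\<dots> = length (filter (\<lambda>y. y \<le> t) s)"
    by (simp add: length_filter_conv_card)
  also have "\<dots> = length (filter (\<lambda>i. a i \<le> t) [1..<Suc n])"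
    by (simp add: s_def filter_sort filter_map o_def del: upt_Suc)
  also have "\<dots> = card (set (filter (\<lambda>i. a i \<le> t) [1..<Suc n]))"
    by (intro distinct_card[symmetric]) (simp del: upt_Suc)
  also have "set (filter (\<lambda>i. a i \<le> t) [1..<Suc n]) = {i \<in> {1..n}. a i \<le> t}"
    by auto
  finally show ?thesis .
qed

text \<open>Only \<open>j - 1\<close> of the indices lie below \<open>j\<close>, so discarding them
  loses at most that many.\<close>

lemma kmin_le_imp_card_tail_ge:
  assumes "1 \<le> j" "j \<le> k" "k \<le> n" "kmin k n a \<le> t"
  shows "k - j + 1 \<le> card {i \<in> {j..n}. a i \<le> t}"
proof -
  have "k \<le> card {i \<in> {1..n}. a i \<le> t}"
    using assms by (intro kmin_le_imp_card_ge) auto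
  also have "\<dots> \<le> card ({1..<j} \<union> {i \<in> {j..n}. a i \<le> t})"
    by (intro card_mono) auto
  also have "\<dots> \<le> (j - 1) + card {i \<in> {j..n}. a i \<le> t}"
    using card_Un_le[of "{1..<j}" "{i \<in> {j..n}. a i \<le> t}"] by simp
  finally show ?thesis
    using assms by linarith
qed

text \<open>Markov's inequality for the number of events that occur. Its expectation is the sum of
  the probabilities by linearity, however the events depend on each other.\<close>

lemma (in prob_space) prob_card_ge_le:
  assumes "finite I" "\<And>i. i \<in> I \<Longrightarrow> E i \<in> events" "0 < r"
  shows "prob {\<omega> \<in> space M. r \<le> card {i \<in> I. \<omega> \<in> E i}} \<le> (\<Sum>i\<in>I. prob (E i)) / real r"
proof -
  define N where "N = (\<lambda>\<omega>. \<Sum>i\<in>I. indicator (E i) \<omega> :: real)"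
  have N: "N \<omega> = real (card {i \<in> I. \<omega> \<in> E i})" for \<omega>
    using assms(1) by (simp add: N_def indicator_def sum.If_cases Int_def)
  have int: "integrable M (\<lambda>\<omega>. indicator (E i) \<omega> :: real)" if "i \<in> I" for i
    using assms(2)[OF that] by (simp add: integrable_indicator_iff emeasure_eq_measure)
  have intN: "integrable M N"
    unfolding N_def using int by (rule Bochner_Integration.integrable_sum)
  have "prob {\<omega> \<in> space M. r \<le> card {i \<in> I. \<omega> \<in> E i}} = prob {\<omega> \<in> space M. real r \<le> N \<omega>}"
    by (simp add: N)
  also have "\<dots> \<le> expectation N / real r"
    using intN assms(3) by (intro integral_Markov_inequality_measure[where A = "{}"]) (auto simp: N_def sum_nonneg)
  also have "expectation N = (\<Sum>i\<in>I. prob (E i))"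
    unfolding N_def using int assms(2) by (simp add: Bochner_Integration.integral_sum)
  finally show ?thesis .
qed

text \<open>The truncation \<open>max t 0\<close> covers negative \<open>t\<close>, where the bound
  becomes 0, and keeps the thresholds in the range of the \<alpha>-condition.\<close>

lemma (in prob_space) prob_kmin_le:
  fixes \<xi> :: "nat \<Rightarrow> 'a \<Rightarrow> real" and x :: "nat \<Rightarrow> real"
  assumes "1 \<le> j" "j \<le> k" "k \<le> n"
    and x: "\<And>i. i \<in> {j..n} \<Longrightarrow> 0 < x i"
    and meas: "\<And>i. i \<in> {j..n} \<Longrightarrow> \<xi> i \<in> borel_measurable M"
    and alpha: "\<And>i. i \<in> {j..n} \<Longrightarrow> alpha_condition M \<alpha> (\<xi> i)"
  shows "\<P>(\<omega> in M. kmin k n (\<lambda>i. \<bar>x i * \<xi> i \<omega>\<bar>) \<le> t)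
           \<le> \<alpha> * max t 0 * (\<Sum>i=j..n. 1 / x i) / real (k - j + 1)"
proof -
  define E where "E i = {\<omega> \<in> space M. \<bar>\<xi> i \<omega>\<bar> \<le> t / x i}" for i
  have E: "E i \<in> events" if "i \<in> {j..n}" for i
    using meas[OF that] unfolding E_def by measurable
  have sub: "{\<omega> \<in> space M. kmin k n (\<lambda>i. \<bar>x i * \<xi> i \<omega>\<bar>) \<le> t}
      \<subseteq> {\<omega> \<in> space M. k - j + 1 \<le> card {i \<in> {j..n}. \<omega> \<in> E i}}"
  proof safe
    fix \<omega> assume \<omega>: "\<omega> \<in> space M" "kmin k n (\<lambda>i. \<bar>x i * \<xi> i \<omega>\<bar>) \<le> t"
    have "{i \<in> {j..n}. \<bar>x i * \<xi> i \<omega>\<bar> \<le> t} = {i \<in> {j..n}. \<omega> \<in> E i}"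
      using \<omega>(1) x by (auto simp: E_def abs_mult abs_of_pos field_simps)
    then show "k - j + 1 \<le> card {i \<in> {j..n}. \<omega> \<in> E i}"
      using kmin_le_imp_card_tail_ge[OF assms(1-3) \<omega>(2)] by simp
  qed
  \<comment> \<open>Monotonicity of the measure asks that the larger set be an event; as a
    superlevel set of a finite sum of indicators it is one.\<close>
  have count: "(\<Sum>i\<in>{j..n}. indicator (E i) \<omega>) = real (card {i \<in> {j..n}. \<omega> \<in> E i})" for \<omega>
    by (simp add: indicator_def sum.If_cases Int_def)
  have "{\<omega> \<in> space M. k - j + 1 \<le> card {i \<in> {j..n}. \<omega> \<in> E i}} =
      {\<omega> \<in> space M. real (k - j + 1) \<le> (\<Sum>i\<in>{j..n}. indicator (E i) \<omega>)}"
    unfolding count of_nat_le_iff ..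
  also have "\<dots> \<in> events"
    using E by measurable
  finally have "\<P>(\<omega> in M. kmin k n (\<lambda>i. \<bar>x i * \<xi> i \<omega>\<bar>) \<le> t)
      \<le> prob {\<omega> \<in> space M. k - j + 1 \<le> card {i \<in> {j..n}. \<omega> \<in> E i}}"
    using sub by (intro finite_measure_mono)
  also have "\<dots> \<le> (\<Sum>i=j..n. prob (E i)) / real (k - j + 1)"
    using E by (intro prob_card_ge_le) auto
  also have "(\<Sum>i=j..n. prob (E i)) \<le> (\<Sum>i=j..n. \<alpha> * (max t 0 / x i))"
  proof (intro sum_mono)
    fix i assume i: "i \<in> {j..n}"
    have "prob (E i) \<le> \<P>(\<omega> in M. \<bar>\<xi> i \<omega>\<bar> \<le> max t 0 / x i)"
    proof (rule finite_measure_mono)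
      have "t / x i \<le> max t 0 / x i"
        using x[OF i] by (simp add: divide_right_mono)
      then show "E i \<subseteq> {\<omega> \<in> space M. \<bar>\<xi> i \<omega>\<bar> \<le> max t 0 / x i}"
        by (auto simp: E_def)
      show "{\<omega> \<in> space M. \<bar>\<xi> i \<omega>\<bar> \<le> max t 0 / x i} \<in> events"
        using meas[OF i] by measurable
    qed
    also have "\<dots> \<le> \<alpha> * (max t 0 / x i)"
      using alpha[OF i] x[OF i] unfolding alpha_condition_def
      by (elim allE[of _ "max t 0 / x i"] impE) auto
    finally show "prob (E i) \<le> \<alpha> * (max t 0 / x i)" .
  qed
  also have "\<dots> = \<alpha> * max t 0 * (\<Sum>i=j..n. 1 / x i)"
    by (simp add: sum_distrib_left)
  finally show ?thesis
    by (simp add: divide_right_mono)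
qed

theorem theorem4p5:
  fixes M :: "'a measure" and \<xi> :: "nat \<Rightarrow> 'a \<Rightarrow> real"
    and x b :: "nat \<Rightarrow> real" and \<alpha> \<delta> A :: real and k n :: nat
  assumes "prob_space M"
    and "\<alpha> > 0" and "0 < \<delta>" and "\<delta> < 1" and "A > 1"
    and "1 \<le> k" and "k \<le> n"
    and "\<And>i. i \<in> {1..n} \<Longrightarrow> 0 < x i"
    and "mono_on {1..n} x"
    and "\<And>j. j \<in> {1..n} \<Longrightarrow> b j = (\<Sum>i=j..n. 1 / x i)"
    and "\<And>i. i \<in> {1..n} \<Longrightarrow> \<xi> i \<in> borel_measurable M"
    and "\<And>i. i \<in> {1..n} \<Longrightarrow> alpha_condition M \<alpha> (\<xi> i)"
    and "\<And>i. i \<in> {1..n} \<Longrightarrow> cdf_decay M \<delta> A (\<xi> i)"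
  shows "\<forall>m. is_median M (\<lambda>\<omega>. kmin k n (\<lambda>i. \<bar>x i * \<xi> i \<omega>\<bar>)) m \<longrightarrow>
           m \<ge> \<delta> / (2 * A * \<alpha>) * (MAX j\<in>{1..k}. real (k - j + 1) / b j)"
proof (intro allI impI)
  interpret prob_space M by fact
  let ?Z = "\<lambda>\<omega>. kmin k n (\<lambda>i. \<bar>x i * \<xi> i \<omega>\<bar>)"
  fix m assume med: "is_median M ?Z m"
  define C where "C = \<delta> / (2 * A * \<alpha>)"
  \<comment> \<open>Here \<open>2 * \<alpha> * C\<close> equals \<open>\<delta> / A\<close>, which
    is below 1 because \<delta> < 1 < A.\<close>
  have C: "0 < C" "2 * \<alpha> * C \<le> 1"
    using assms(2-5) by (auto simp: C_def field_simps)
  have main: "C * (real (k - j + 1) / b j) \<le> m" if j: "j \<in> {1..k}" for j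
  proof -
    define r where "r = real (k - j + 1)"
    have r: "0 < r"
      by (simp add: r_def)
    have bj: "b j = (\<Sum>i=j..n. 1 / x i)"
      using j assms(7,10) by auto
    have b: "0 < b j"
      unfolding bj using j assms(7,8) by (intro sum_pos) auto
    \<comment> \<open>The sign of \<open>m\<close> is still open, so the estimate is first derived
      for its positive part.\<close>
    define t where "t = max m 0"
    have "1 / 2 \<le> \<P>(\<omega> in M. ?Z \<omega> \<le> m)"
      using med by (simp add: is_median_def)
    also have "\<dots> \<le> \<alpha> * t * b j / r"
      unfolding bj r_def t_def using j assms(7,8,11,12) by (intro prob_kmin_le) auto
    finally have "r \<le> 2 * \<alpha> * t * b j"
      using r by (simp add: field_simps)
    then have "C * r \<le> (2 * \<alpha> * C) * (t * b j)"
      using C(1) by (simp add: mult.assoc mult.left_commute)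
    also have "\<dots> \<le> 1 * (t * b j)"
      using C(2) b by (intro mult_right_mono) (auto simp: t_def)
    finally have le: "C * (r / b j) \<le> t"
      using b by (simp add: field_simps)
    \<comment> \<open>A positive lower bound for \<open>max m 0\<close> excludes
      \<open>m \<le> 0\<close>, so the maximum is \<open>m\<close> itself.\<close>
    have "0 < C * (r / b j)"
      using C(1) r b by simp
    with le show ?thesis
      by (simp add: t_def r_def max_def split: if_splits)
  qed
  \<comment> \<open>The maximum over the nonempty finite range is attained, so the bound for a
    single \<open>j\<close> suffices.\<close>
  have "(MAX j\<in>{1..k}. real (k - j + 1) / b j) \<in> (\<lambda>j. real (k - j + 1) / b j) ` {1..k}"
    using assms(6) by (intro Max_in) auto
  then obtain j where "j \<in> {1..k}" "(MAX j\<in>{1..k}. real (k - j + 1) / b j) = real (k - j + 1) / b j"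
    by auto
  then show "\<delta> / (2 * A * \<alpha>) * (MAX j\<in>{1..k}. real (k - j + 1) / b j) \<le> m"
    using main by (simp add: C_def)
qed

end
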